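(* Let $\varphi$ be a function of $p=\{p_1,\dots,p_n\}$, let $\gamma^0$ and $\Lambda^0$ be non-zero constants, and let $F_1,\dots,F_n$ be functions of $p$ satisfying $$\frac{\partial F_b}{\partial p_a}=\Lambda^0\,\delta_b^a .$$ Consider, in the coordinates $(x,p,z)$ of the $(2n+1)$-dimensional contact manifold $(\mathcal{C},\lambda=dz-p_a\,dx^a)$, the dynamical system $$\frac{d\Delta^a}{dt}=-\frac{\partial F_b}{\partial p_a}\Delta^b-\frac{d\Gamma}{d\Delta^0}\Delta^a,\qquad \frac{dp_a}{dt}=F_a(p),\qquad \frac{d\Delta^0}{dt}=-\Gamma(\Delta^0),\qquad \Gamma(\Delta^0)=\gamma^0\Delta^0 .$$ If $\Lambda^0+\gamma^0>0$ and $\gamma^0>0$, then the flow asymptotically approaches the embedded Legendre submanifold $\mathcal{A}_\varphi^{\mathcal{C}}$.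
   Context: Everything is smooth; repeated indices are summed over $1,\dots,n$. Here $\Delta^0=x^jp_j-\varphi(p)-z$ and $\Delta^a=x^a-\frac{\partial\varphi}{\partial p_a}(p)$, so that the system is a system of ODEs for $(x,p,z)$ (it is the flow of the contact Hamiltonian vector field of $h=\Delta^aF_a+\Gamma(\Delta^0)$). The embedded Legendre submanifold generated by $-\varphi$ is $\mathcal{A}_\varphi^{\mathcal{C}}=\{\Delta^0=\Delta^1=\dots=\Delta^n=0\}=\{x^a=\partial\varphi/\partial p_a,\ z=p_i\,\partial\varphi/\partial p_i-\varphi(p)\}$. "The flow asymptotically approaches $\mathcal{A}_\varphi^{\mathcal{C}}$" means that along every solution $(x(t),p(t),z(t))$, $t\ge0$, one has $\lim_{t\to\infty}\Delta^0(t)=0$ and $\lim_{t\to\infty}\Delta^a(t)=0$ for all $a\in\{1,\dots,n\}$. *)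

theory Defs
  imports "HOL-Analysis.Analysis"
begin

definition pd :: "'n::finite \<Rightarrow> (real^'n \<Rightarrow> real) \<Rightarrow> real^'n \<Rightarrow> real" where
  "pd a f p = deriv (\<lambda>s. f (p + s *\<^sub>R axis a 1)) 0"

fun Ck_on :: "nat \<Rightarrow> (real^'n::finite) set \<Rightarrow> (real^'n \<Rightarrow> real) \<Rightarrow> bool" where
  "Ck_on 0 P f \<longleftrightarrow> continuous_on P f"
| "Ck_on (Suc k) P f \<longleftrightarrow> f differentiable_on P \<and> (\<forall>a. Ck_on k P (pd a f))"

text \<open>Intended for open \<open>P\<close>, where it is the usual C-infinity condition.\<close>

definition smooth_on :: "(real^'n::finite) set \<Rightarrow> (real^'n \<Rightarrow> real) \<Rightarrow> bool" where
  "smooth_on P f \<longleftrightarrow> (\<forall>k. Ck_on k P f)"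

definition Delta0 ::
  "(real^'n::finite \<Rightarrow> real) \<Rightarrow> real^'n \<Rightarrow> real^'n \<Rightarrow> real \<Rightarrow> real" where
  "Delta0 \<phi> x p z = (\<Sum>j\<in>UNIV. x $ j * p $ j) - \<phi> p - z"

definition Delta ::
  "(real^'n::finite \<Rightarrow> real) \<Rightarrow> 'n \<Rightarrow> real^'n \<Rightarrow> real^'n \<Rightarrow> real" where
  "Delta \<phi> a x p = x $ a - pd a \<phi> p"

definition legendre_submanifold ::
  "(real^'n::finite) set \<Rightarrow> (real^'n \<Rightarrow> real) \<Rightarrow> ((real^'n) \<times> (real^'n) \<times> real) set" where
  "legendre_submanifold P \<phi> =
     {(x, p, z). p \<in> P \<and> Delta0 \<phi> x p z = 0 \<and> (\<forall>a. Delta \<phi> a x p = 0)}"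

lemma legendre_submanifold_iff:
  "(x, p, z) \<in> legendre_submanifold P \<phi> \<longleftrightarrow>
     p \<in> P \<and> (\<forall>a. x $ a = pd a \<phi> p) \<and> z = (\<Sum>i\<in>UNIV. p $ i * pd i \<phi> p) - \<phi> p"
  by (auto simp: legendre_submanifold_def Delta0_def Delta_def mult.commute)

text \<open>
  Forward solutions in the coordinates \<open>(x, p, z)\<close>, where \<open>P\<close> is the range of the
  coordinate \<open>p\<close>.  The time derivatives are those of the functions \<open>Delta\<close> and \<open>Delta0\<close>
  evaluated along the curve (one-sided at time 0).  Differentiability of \<open>x\<close> and \<open>z\<close> need
  not be demanded: for smooth \<open>\<phi>\<close> and open \<open>P\<close> it follows from that of \<open>p\<close>, \<open>Delta\<close>
  and \<open>Delta0\<close>.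
\<close>

definition is_solution ::
  "(real^'n::finite) set \<Rightarrow> (real^'n \<Rightarrow> real) \<Rightarrow> ('n \<Rightarrow> real^'n \<Rightarrow> real) \<Rightarrow> (real \<Rightarrow> real)
    \<Rightarrow> (real \<Rightarrow> real^'n) \<Rightarrow> (real \<Rightarrow> real^'n) \<Rightarrow> (real \<Rightarrow> real) \<Rightarrow> bool" where
  "is_solution P \<phi> F \<Gamma> x p z \<longleftrightarrow>
     (\<forall>t\<ge>0. p t \<in> P \<and>
       (\<forall>a. ((\<lambda>s. Delta \<phi> a (x s) (p s)) has_real_derivative
               - (\<Sum>b\<in>UNIV. pd a (F b) (p t) * Delta \<phi> b (x t) (p t))
               - deriv \<Gamma> (Delta0 \<phi> (x t) (p t) (z t)) * Delta \<phi> a (x t) (p t))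
             (at t within {0..})) \<and>
       (\<forall>a. ((\<lambda>s. p s $ a) has_real_derivative F a (p t)) (at t within {0..})) \<and>
       ((\<lambda>s. Delta0 \<phi> (x s) (p s) (z s)) has_real_derivative
            - \<Gamma> (Delta0 \<phi> (x t) (p t) (z t)))
          (at t within {0..}))"

text \<open>
  Approach to \<open>legendre_submanifold P \<phi>\<close> means that its defining functions tend to 0 along
  every forward solution; it is not convergence of the metric distance to that set.
\<close>

definition flow_approaches_legendre ::
  "(real^'n::finite) set \<Rightarrow> (real^'n \<Rightarrow> real) \<Rightarrow> ('n \<Rightarrow> real^'n \<Rightarrow> real) \<Rightarrow> (real \<Rightarrow> real)
    \<Rightarrow> bool" where
  "flow_approaches_legendre P \<phi> F \<Gamma> \<longleftrightarrow>
     (\<forall>x p z. is_solution P \<phi> F \<Gamma> x p z \<longrightarrow>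
        ((\<lambda>t. Delta0 \<phi> (x t) (p t) (z t)) \<longlongrightarrow> 0) at_top \<and>
        (\<forall>a. ((\<lambda>t. Delta \<phi> a (x t) (p t)) \<longlongrightarrow> 0) at_top))"

end

theory Submission imports Defs "HOL-Real_Asymp.Real_Asymp" begin

text \<open>Along a solution the defining functions of the Legendre submanifold decouple into scalar
  linear equations u' = -k u. For \<open>Delta0\<close> the rate k is \<gamma>0. For each
  \<open>Delta \<phi> a\<close> it is \<Lambda>0 + \<gamma>0, because the Jacobian of
  \<open>F\<close> is \<Lambda>0 times the identity and \<Gamma> has constant slope \<gamma>0. Both
  rates are positive, so each function is a constant multiple of exp (-k t) and decays to 0;
  \<open>linear_decay_tendsto_0\<close> supplies this.\<close>

lemma linear_decay_tendsto_0:
  fixes u :: "real \<Rightarrow> real" and k :: real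
  assumes "k > 0"
    and deriv: "\<And>t. t \<ge> 0 \<Longrightarrow> (u has_real_derivative - (k * u t)) (at t within {0..})"
  shows "(u \<longlongrightarrow> 0) at_top"
proof -
  \<comment> \<open>Integrating factor: in the product rule the two terms cancel. Since
    \<open>{0..}\<close> is convex, a vanishing derivative within it forces constancy, the one-sided
    derivative at 0 included.\<close>
  have "((\<lambda>s. u s * exp (k * s)) has_real_derivative 0) (at t within {0..})" if "t \<in> {0..}" for t
    using that by (auto intro!: derivative_eq_intros deriv simp: algebra_simps)
  then obtain c where c: "\<And>t. t \<in> {0..} \<Longrightarrow> u t * exp (k * t) = c"
    using has_field_derivative_zero_constant[of "{0..}" "\<lambda>s. u s * exp (k * s)"] by auto
  have "u t = c * exp (- (k * t))" if "t \<ge> 0" for t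
    using c[of t] that by (auto simp: exp_minus field_simps)
  then have "\<forall>\<^sub>F t in at_top. c * exp (- (k * t)) = u t"
    by (intro eventually_at_top_linorderI[of 0]) simp
  moreover have "((\<lambda>t. c * exp (- (k * t))) \<longlongrightarrow> 0) at_top"
    using \<open>k > 0\<close> by real_asymp
  ultimately show ?thesis
    by (rule Lim_transform_eventually[rotated])
qed

theorem theorem4p4:
  fixes P :: "(real^'n::finite) set"
    and \<phi> :: "real^'n \<Rightarrow> real"
    and F :: "'n \<Rightarrow> real^'n \<Rightarrow> real"
    and \<Gamma> :: "real \<Rightarrow> real"
    and \<gamma>0 \<Lambda>0 :: real
  assumes "open P"
    and "smooth_on P \<phi>"
    and "\<And>b. smooth_on P (F b)"
    and "\<gamma>0 \<noteq> 0" and "\<Lambda>0 \<noteq> 0"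
    and "\<And>a b p. p \<in> P \<Longrightarrow> pd a (F b) p = \<Lambda>0 * (if a = b then 1 else 0)"
    and "\<And>s. \<Gamma> s = \<gamma>0 * s"
    and "\<Lambda>0 + \<gamma>0 > 0" and "\<gamma>0 > 0"
  shows "flow_approaches_legendre P \<phi> F \<Gamma>"
  unfolding flow_approaches_legendre_def
proof (intro allI impI conjI)
  fix x p z
  assume sol: "is_solution P \<phi> F \<Gamma> x p z"
  have "((\<lambda>s. Delta0 \<phi> (x s) (p s) (z s)) has_real_derivative
      - (\<gamma>0 * Delta0 \<phi> (x t) (p t) (z t))) (at t within {0..})" if "t \<ge> 0" for t
    using sol that unfolding is_solution_def assms(7) by blast
  then show "((\<lambda>t. Delta0 \<phi> (x t) (p t) (z t)) \<longlongrightarrow> 0) at_top"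
    by (rule linear_decay_tendsto_0[OF \<open>\<gamma>0 > 0\<close>])
  fix a
  \<comment> \<open>The pointwise formula becomes an equation of functions, so that
    \<open>deriv\<close> can be evaluated.\<close>
  have "\<Gamma> = (\<lambda>s. \<gamma>0 * s)"
    using assms(7) by auto
  then have deriv_\<Gamma>: "deriv \<Gamma> s = \<gamma>0" for s
    by (auto intro!: DERIV_imp_deriv derivative_eq_intros)
  have "((\<lambda>s. Delta \<phi> a (x s) (p s)) has_real_derivative
      - ((\<Lambda>0 + \<gamma>0) * Delta \<phi> a (x t) (p t))) (at t within {0..})" if "t \<ge> 0" for t
  proof -
    \<comment> \<open>The Jacobian of \<open>F\<close> is prescribed only on
      \<open>P\<close>.\<close>
    have "p t \<in> P"
      using sol that unfolding is_solution_def by blast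
    then have "(\<Sum>b\<in>UNIV. pd a (F b) (p t) * Delta \<phi> b (x t) (p t)) = \<Lambda>0 * Delta \<phi> a (x t) (p t)"
      \<comment> \<open>Moving the products into the conditional exposes a Kronecker delta, which
        reduces the sum to its term b = a.\<close>
      by (simp add: assms(6) if_distrib[of "(*) _"] if_distrib[of "\<lambda>c. c * _"] cong: if_cong)
    moreover have "((\<lambda>s. Delta \<phi> a (x s) (p s)) has_real_derivative
        - (\<Sum>b\<in>UNIV. pd a (F b) (p t) * Delta \<phi> b (x t) (p t))
        - deriv \<Gamma> (Delta0 \<phi> (x t) (p t) (z t)) * Delta \<phi> a (x t) (p t)) (at t within {0..})"
      using sol that unfolding is_solution_def by blast
    ultimately show ?thesis
      by (simp add: deriv_\<Gamma> algebra_simps)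
  qed
  then show "((\<lambda>t. Delta \<phi> a (x t) (p t)) \<longlongrightarrow> 0) at_top"
    by (rule linear_decay_tendsto_0[OF \<open>\<Lambda>0 + \<gamma>0 > 0\<close>])
qed

end
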